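(* Let $(\mathbb{X}, d, \Sigma, \mu)$ be a metric measure space of dimension $D>0$ (with constants $c_D,\rho>0$). Suppose $P$ is a probability measure on $(\mathbb{X},\Sigma)$, absolutely continuous with respect to $\mu$, with full dimension on $\mathcal{X} \subseteq \mathbb{X}$ (with functions $\gamma_*,\gamma^*:\mathcal{X}\to(0,\infty)$) and density function $p : \mathcal{X} \to [0,\infty)$. Let $k \le n$ be positive integers, let $X_1,\dots,X_n$ be IID samples from $P$, and let $x \in \mathcal{X}$ be a point at which the full-dimension inequalities hold. Write $\gamma_*=\gamma_*(x)$ and $\gamma^*=\gamma^*(x)$. If $r \in \left[\left(\frac{k}{\gamma_* n}\right)^{1/D}, \rho\right]$, then \[\mathbb{P}\left[\varepsilon_k(x) > r\right] \leq e^{-\gamma_* r^D n}\left(e\,\frac{\gamma_* r^D n}{k}\right)^k,\] and, if $r \in \left[0, \min\left\{\left(\frac{k}{\gamma^* n}\right)^{1/D}, \rho\right\}\right]$, then \[\mathbb{P}\left[\varepsilon_k(x) \leq r\right] \leq \left(\frac{e\gamma^* r^D n}{k}\right)^{k\gamma_*/\gamma^*}.\]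
   Context: A metric measure space is a quadruple $(\mathbb{X}, d, \Sigma, \mu)$ where $\mathbb{X}$ is a set, $d$ is a metric on $\mathbb{X}$, $\Sigma$ is a $\sigma$-algebra on $\mathbb{X}$ containing the Borel $\sigma$-algebra induced by $d$, and $\mu:\Sigma\to[0,\infty]$ is a $\sigma$-finite measure. $B(x,r)=\{y : d(x,y)<r\}$ is the open ball. The space has dimension $D$ if there exist constants $c_D,\rho>0$ such that $\mu(B(x,r)) = c_D r^D$ for all $r\in[0,\rho]$ and all $x$. A measure $P$ on $(\mathbb{X},\Sigma)$ has full dimension on a set $\mathcal{X}\subseteq\mathbb{X}$ if there exist functions $\gamma_*,\gamma^*:\mathcal{X}\to(0,\infty)$ such that, for all $r\in[0,\rho]$ and $\mu$-almost all $x\in\mathcal{X}$, $\gamma_*(x) r^D \le P(B(x,r)) \le \gamma^*(x) r^D$ (the "full-dimension inequalities" at $x$). $P$ is carried by $\mathcal{X}$, with density $p$ with respect to $\mu$. For $x\in\mathcal{X}$, $\varepsilon_k(x)$ denotes the distance $d(x,X_i)$ from $x$ to its $k$-th nearest neighbor $X_i$ in $\{X_1,\dots,X_n\}$.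
   Formalization: The second bound at the endpoint r = ρ is proved only if P gives measure zero to the sphere {y : d(x,y) = ρ}; without this it can fail, since the full-dimension inequalities control only open balls of radius at most ρ. For r < ρ nothing is added. *)

theory Defs
  imports "HOL-Probability.Probability"
begin

locale metric_measure_space = sigma_finite_measure \<mu>
  for \<mu> :: "'a::metric_space measure" +
  assumes space_eq_UNIV: "space \<mu> = UNIV"
    and borel_subset_sets: "sets borel \<subseteq> sets \<mu>"

text \<open>The exponent \<open>D\<close> is real. For \<open>D > 0\<close>, the convention \<open>0 powr D = 0\<close> of the library agrees
  with \<open>0\<^sup>D = 0\<close>, so \<open>r = 0\<close> is included with its usual meaning.\<close>

definition has_dimension :: "'a::metric_space measure \<Rightarrow> real \<Rightarrow> real \<Rightarrow> real \<Rightarrow> bool" where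
  "has_dimension \<mu> D c \<rho> \<longleftrightarrow> c > 0 \<and> \<rho> > 0 \<and>
     (\<forall>r\<in>{0..\<rho>}. \<forall>x. emeasure \<mu> (ball x r) = ennreal (c * r powr D))"

definition full_dimension_ineqs ::
    "'a::metric_space measure \<Rightarrow> real \<Rightarrow> real \<Rightarrow> ('a \<Rightarrow> real) \<Rightarrow> ('a \<Rightarrow> real) \<Rightarrow> 'a \<Rightarrow> bool" where
  "full_dimension_ineqs P D \<rho> \<gamma>\<^sub>l \<gamma>\<^sub>u x \<longleftrightarrow>
     (\<forall>r\<in>{0..\<rho>}. \<gamma>\<^sub>l x * r powr D \<le> measure P (ball x r) \<and> measure P (ball x r) \<le> \<gamma>\<^sub>u x * r powr D)"

definition full_dimension_on ::
    "'a::metric_space measure \<Rightarrow> 'a measure \<Rightarrow> real \<Rightarrow> real \<Rightarrow> 'a set \<Rightarrow> ('a \<Rightarrow> real) \<Rightarrow> ('a \<Rightarrow> real) \<Rightarrow> bool" where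
  "full_dimension_on \<mu> P D \<rho> S \<gamma>\<^sub>l \<gamma>\<^sub>u \<longleftrightarrow>
     (\<forall>x\<in>S. \<gamma>\<^sub>l x > 0 \<and> \<gamma>\<^sub>u x > 0) \<and>
     (AE x in \<mu>. x \<in> S \<longrightarrow> full_dimension_ineqs P D \<rho> \<gamma>\<^sub>l \<gamma>\<^sub>u x)"

text \<open>A density given only on \<open>S\<close> is extended by zero outside \<open>S\<close>; in particular \<open>P\<close> is carried
  by \<open>S\<close>. The set \<open>S\<close> itself need not be measurable.\<close>

definition has_density_on ::
    "'a measure \<Rightarrow> 'a measure \<Rightarrow> 'a set \<Rightarrow> ('a \<Rightarrow> real) \<Rightarrow> bool" where
  "has_density_on \<mu> P S p \<longleftrightarrow>
     (\<forall>y\<in>S. p y \<ge> 0) \<and>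
     (\<lambda>y. p y * indicator S y) \<in> borel_measurable \<mu> \<and>
     P = density \<mu> (\<lambda>y. ennreal (p y * indicator S y))"

text \<open>The distance from \<open>x\<close> to its \<open>k\<close>-th nearest neighbour among \<open>X 1, \<dots>, X n\<close> is the \<open>k\<close>-th
  smallest of the \<open>n\<close> distances, counted with multiplicity; it does not depend on how ties
  are broken. It is meaningful for \<open>1 \<le> k \<le> n\<close>.\<close>

definition knn_dist :: "nat \<Rightarrow> nat \<Rightarrow> (nat \<Rightarrow> 'a::metric_space) \<Rightarrow> 'a \<Rightarrow> real" where
  "knn_dist k n X x = sort (map (\<lambda>i. dist x (X i)) [1..<n+1]) ! (k - 1)"

end

theory Submission imports Defs begin

text \<open>Let \<open>N\<close> be the number of samples in the closed ball of radius \<open>r\<close> about \<open>x\<close>, so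
  that \<open>\<epsilon>\<^sub>k(x) \<le> r\<close> means \<open>N \<ge> k\<close>. For any count \<open>N\<close> of independent events with
  probabilities \<open>p\<^sub>i\<close> of sum \<open>m\<close>, \<open>\<bbbE>[t\<^sup>N] = \<Prod>\<^sub>i (1 + (t - 1) p\<^sub>i) \<le> exp((t - 1) m)\<close>,
  and Markov's inequality with \<open>t = k / a\<close> bounds both tails by \<open>exp(-a) (e a / k)\<^sup>k\<close>: the lower
  one if \<open>k \<le> a \<le> m\<close>, where \<open>t \<le> 1\<close>, and the upper one if \<open>m \<le> a \<le> k\<close>, where
  \<open>t \<ge> 1\<close>. The choices \<open>a = \<gamma>\<^sub>* r\<^sup>D n\<close> and \<open>a = \<gamma>\<^sup>* r\<^sup>D n\<close> give the two
  inequalities, the second one even with exponent \<open>k\<close>, which may be lowered to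
  \<open>k \<gamma>\<^sub>* / \<gamma>\<^sup>*\<close> because \<open>\<gamma>\<^sub>* \<le> \<gamma>\<^sup>*\<close> and a probability is at most 1.

  The full-dimension inequalities concern open balls. A closed ball of radius \<open>r < \<rho>\<close> inherits the
  upper one from the open balls shrinking to it; at \<open>r = \<rho>\<close> this argument is not available, and
  the sphere has to be null.\<close>

lemma sorted_nth_le_iff:
  fixes ys :: "'b::linorder list"
  assumes "sorted ys" "j < length ys"
  shows "ys ! j \<le> r \<longleftrightarrow> j < length (filter (\<lambda>y. y \<le> r) ys)"
proof -
  let ?K = "{i. i < length ys \<and> ys ! i \<le> r}"
  have "j < card ?K" if "ys ! j \<le> r"
  proof -
    have "ys ! i \<le> r" if "i \<le> j" for i
      using sorted_nth_mono[OF assms(1) that assms(2)] \<open>ys ! j \<le> r\<close> by simp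
    then have "{..j} \<subseteq> ?K" using assms(2) by auto
    then have "card {..j} \<le> card ?K" by (intro card_mono) simp_all
    then show ?thesis by simp
  qed
  moreover have "card ?K \<le> j" if "\<not> ys ! j \<le> r"
  proof -
    have "i < j" if "i < length ys" "ys ! i \<le> r" for i
      using sorted_nth_mono[OF assms(1), of j i] that \<open>\<not> ys ! j \<le> r\<close> by (meson leI order_trans)
    then have "?K \<subseteq> {..<j}" by auto
    then have "card ?K \<le> card {..<j}" by (intro card_mono) simp_all
    then show ?thesis by simp
  qed
  ultimately show ?thesis unfolding length_filter_conv_card by linarith
qed

lemma knn_dist_le_iff:
  assumes "1 \<le> k" "k \<le> n"
  shows "knn_dist k n X x \<le> r \<longleftrightarrow> k \<le> card {i \<in> {1..n}. X i \<in> cball x r}"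
proof -
  let ?ds = "map (\<lambda>i. dist x (X i)) [1..<n+1]"
  have "knn_dist k n X x \<le> r \<longleftrightarrow> k - 1 < length (filter (\<lambda>d. d \<le> r) (sort ?ds))"
    unfolding knn_dist_def using assms by (intro sorted_nth_le_iff) auto
  also have "length (filter (\<lambda>d. d \<le> r) (sort ?ds)) = length (filter (\<lambda>d. d \<le> r) ?ds)"
    by (simp add: filter_sort)
  also have "\<dots> = length (filter (\<lambda>i. X i \<in> cball x r) [1..<n+1])"
    by (simp add: filter_map o_def)
  also have "\<dots> = card {i \<in> {1..n}. X i \<in> cball x r}"
    by (subst distinct_card[symmetric]) (auto intro!: arg_cong[where f = card])
  finally show ?thesis using assms by auto
qed

lemma powr_le_iff_le_powr_inverse:
  fixes x y a :: real
  assumes "0 \<le> x" "0 \<le> y" "0 < a"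
  shows "x powr a \<le> y \<longleftrightarrow> x \<le> y powr (1 / a)"
proof
  assume "x powr a \<le> y"
  then have "(x powr a) powr (1 / a) \<le> y powr (1 / a)"
    using assms by (intro powr_mono2) auto
  then show "x \<le> y powr (1 / a)" using assms by (simp add: powr_powr)
next
  assume "x \<le> y powr (1 / a)"
  then have "x powr a \<le> (y powr (1 / a)) powr a"
    using assms by (intro powr_mono2) auto
  then show "x powr a \<le> y" using assms by (simp add: powr_powr)
qed

lemma min_one_powr_le:
  fixes y a b :: real
  assumes "0 \<le> y" "0 \<le> a" "a \<le> b"
  shows "min 1 (y powr b) \<le> y powr a"
proof (cases "y \<le> 1")
  case True
  then show ?thesis using assms powr_mono'[of a b y] by linarith
next
  case False
  then show ?thesis using assms ge_one_powr_ge_zero[of y a] by linarith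
qed

definition chernoff_bound :: "nat \<Rightarrow> real \<Rightarrow> real" where
  "chernoff_bound k a = exp (- a) * (exp 1 * a / k) ^ k"

lemma chernoff_bound_eq_exp_div_power:
  fixes a :: real
  assumes "0 < a"
  shows "chernoff_bound k a = exp ((k / a - 1) * a) / (k / a) ^ k"
proof -
  have "exp ((k / a - 1) * a) = exp (- a) * exp 1 ^ k"
    using assms
    by (simp add: left_diff_distrib exp_diff exp_minus divide_inverse flip: exp_of_nat_mult)
  then show ?thesis by (simp add: chernoff_bound_def power_divide power_mult_distrib)
qed

lemma min_one_chernoff_bound_le_powr:
  fixes a s :: real
  assumes "0 < k" "0 \<le> a" "0 \<le> s" "s \<le> k"
  shows "min 1 (chernoff_bound k a) \<le> (exp 1 * a / k) powr s"
proof -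
  have "chernoff_bound k a \<le> (exp 1 * a / k) powr k"
    using assms by (simp add: chernoff_bound_def powr_realpow' mult_left_le_one_le)
  then have "min 1 (chernoff_bound k a) \<le> min 1 ((exp 1 * a / k) powr k)" by simp
  also have "\<dots> \<le> (exp 1 * a / k) powr s"
    using assms by (intro min_one_powr_le) auto
  finally show ?thesis .
qed

definition event_count :: "('i \<Rightarrow> 'a set) \<Rightarrow> 'i set \<Rightarrow> 'a \<Rightarrow> nat" where
  "event_count A I \<omega> = card {i \<in> I. \<omega> \<in> A i}"

lemma power_event_count_eq_prod_indicator:
  fixes t :: "'b::comm_ring_1"
  assumes "finite I"
  shows "t ^ event_count A I \<omega> = (\<Prod>i\<in>I. 1 + (t - 1) * indicator (A i) \<omega>)"
proof -
  have "(\<Prod>i\<in>I. 1 + (t - 1) * indicator (A i) \<omega>) = (\<Prod>i\<in>I. if \<omega> \<in> A i then t else 1)"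
    by (intro prod.cong) auto
  also have "\<dots> = t ^ event_count A I \<omega>"
    using assms by (simp add: prod.If_cases Int_def event_count_def)
  finally show ?thesis by simp
qed

context prob_space
begin

lemma indep_vars_indicator:
  assumes "indep_events A I"
  shows "indep_vars (\<lambda>_. borel) (\<lambda>i. indicator (A i) :: 'a \<Rightarrow> real) I"
  unfolding indep_vars_def2
proof (intro conjI ballI)
  have events: "A i \<in> events" if "i \<in> I" for i
    using assms that by (auto simp: indep_events_def)
  then show "random_variable borel (indicator (A i) :: 'a \<Rightarrow> real)" if "i \<in> I" for i
    using that by simp
  have "indep_sets (\<lambda>i. sigma_sets (space M) {A i}) I"
    using assms by (intro indep_sets_sigma) (auto simp: indep_events_def_alt Int_stable_def)
  then show "indep_sets (\<lambda>i. {indicator (A i) -` B \<inter> space M |B. B \<in> sets (borel :: real measure)}) I"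
  proof (rule indep_sets_mono_sets, intro subsetI)
    fix i and C assume "i \<in> I"
    then have A: "A i \<subseteq> space M" using events sets.sets_into_space by blast
    assume "C \<in> {indicator (A i) -` B \<inter> space M |B. B \<in> sets (borel :: real measure)}"
    then obtain B :: "real set" where "C = indicator (A i) -` B \<inter> space M" by blast
    also have "\<dots> = (if 1 \<in> B then if 0 \<in> B then space M else A i
        else if 0 \<in> B then space M - A i else {})"
      using A by (auto simp: indicator_def of_bool_def split: if_splits)
    finally show "C \<in> sigma_sets (space M) {A i}"
      by (auto simp: sigma_sets.Empty sigma_sets_top intro: sigma_sets.Compl)
  qed
qed

lemma measurable_event_count:
  assumes "finite I" "\<And>i. i \<in> I \<Longrightarrow> A i \<in> events"
  shows "event_count A I \<in> measurable M (count_space UNIV)"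
proof -
  have "event_count A I = (\<lambda>\<omega>. \<Sum>i\<in>I. if \<omega> \<in> A i then 1 else 0)"
    using assms(1) by (simp add: event_count_def sum.If_cases Int_def fun_eq_iff)
  moreover have "(\<lambda>\<omega>. \<Sum>i\<in>I. if \<omega> \<in> A i then 1 else (0::nat)) \<in> measurable M (count_space UNIV)"
    using assms(2) by (intro measurable_sum_nat measurable_If_set) auto
  ultimately show ?thesis by simp
qed

lemma
  fixes t :: real
  assumes fin: "finite I" and indep: "indep_events A I"
  shows integrable_power_event_count: "integrable M (\<lambda>\<omega>. t ^ event_count A I \<omega>)"
    and expectation_power_event_count:
      "expectation (\<lambda>\<omega>. t ^ event_count A I \<omega>) = (\<Prod>i\<in>I. 1 + (t - 1) * prob (A i))"
proof -
  let ?f = "\<lambda>i \<omega>. 1 + (t - 1) * indicator (A i) \<omega>"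
  have indep_f: "indep_vars (\<lambda>_. borel) ?f I"
    using indep_vars_compose2[OF indep_vars_indicator[OF indep],
        of "\<lambda>_ y. 1 + (t - 1) * y" "\<lambda>_. borel"]
    by simp
  have events: "A i \<in> events" if "i \<in> I" for i
    using indep that by (auto simp: indep_events_def)
  then have integrable_f: "integrable M (?f i)" if "i \<in> I" for i
    using that by (simp add: integrable_indicator_iff emeasure_eq_measure)
  have expectation_f: "expectation (?f i) = 1 + (t - 1) * prob (A i)" if "i \<in> I" for i
    using events[OF that] by (simp add: prob_space integrable_indicator_iff emeasure_eq_measure)
  show "integrable M (\<lambda>\<omega>. t ^ event_count A I \<omega>)"
    unfolding power_event_count_eq_prod_indicator[OF fin]
    by (rule indep_vars_integrable[OF fin indep_f integrable_f])
  show "expectation (\<lambda>\<omega>. t ^ event_count A I \<omega>) = (\<Prod>i\<in>I. 1 + (t - 1) * prob (A i))"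
    unfolding power_event_count_eq_prod_indicator[OF fin]
    by (simp add: indep_vars_lebesgue_integral[OF fin indep_f integrable_f] expectation_f)
qed

lemma expectation_power_event_count_le:
  assumes "finite I" "indep_events A I" "0 \<le> t"
  shows "expectation (\<lambda>\<omega>. t ^ event_count A I \<omega>) \<le> exp ((t - 1) * (\<Sum>i\<in>I. prob (A i)))"
proof -
  have "0 \<le> 1 + (t - 1) * prob (A i)" for i
  proof -
    have "0 \<le> (1 - prob (A i)) + t * prob (A i)" using \<open>0 \<le> t\<close> by simp
    then show ?thesis by (simp add: algebra_simps)
  qed
  then have "(\<Prod>i\<in>I. 1 + (t - 1) * prob (A i)) \<le> (\<Prod>i\<in>I. exp ((t - 1) * prob (A i)))"
    by (intro prod_mono) (auto intro: exp_ge_add_one_self)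
  then show ?thesis
    using assms by (simp add: expectation_power_event_count exp_sum sum_distrib_left)
qed

lemma prob_power_event_count_ge_bound:
  fixes a :: real
  assumes "finite I" "indep_events A I" "0 < a" "0 < k"
    and "(k / a - 1) * (\<Sum>i\<in>I. prob (A i)) \<le> (k / a - 1) * a"
  shows "prob {\<omega> \<in> space M. (k / a) ^ k \<le> (k / a) ^ event_count A I \<omega>} \<le> chernoff_bound k a"
proof -
  let ?t = "k / a"
  have "prob {\<omega> \<in> space M. ?t ^ k \<le> ?t ^ event_count A I \<omega>}
      \<le> expectation (\<lambda>\<omega>. ?t ^ event_count A I \<omega>) / ?t ^ k"
    using assms(1-4)
    by (intro integral_Markov_inequality_measure[where A = "{}"] integrable_power_event_count) auto
  also have "\<dots> \<le> exp ((?t - 1) * (\<Sum>i\<in>I. prob (A i))) / ?t ^ k"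
    using assms(1-4) by (intro divide_right_mono expectation_power_event_count_le) auto
  also have "\<dots> \<le> exp ((?t - 1) * a) / ?t ^ k"
    using assms(3-5) by (intro divide_right_mono) auto
  also have "\<dots> = chernoff_bound k a"
    by (rule chernoff_bound_eq_exp_div_power[OF \<open>0 < a\<close>, symmetric])
  finally show ?thesis .
qed

lemma prob_event_count_le_bound:
  fixes a :: real
  assumes "finite I" "indep_events A I" "0 < k" "k \<le> a" "a \<le> (\<Sum>i\<in>I. prob (A i))"
  shows "prob {\<omega> \<in> space M. event_count A I \<omega> \<le> k} \<le> chernoff_bound k a"
proof -
  have "0 < a" "0 \<le> k / a" "k / a \<le> 1" using assms(3,4) by auto
  then have "prob {\<omega> \<in> space M. event_count A I \<omega> \<le> k}
      \<le> prob {\<omega> \<in> space M. (k / a) ^ k \<le> (k / a) ^ event_count A I \<omega>}"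
    using integrable_power_event_count[OF assms(1,2), THEN borel_measurable_integrable]
    by (intro finite_measure_mono) (auto intro!: power_decreasing)
  also have "\<dots> \<le> chernoff_bound k a"
    using assms \<open>0 < a\<close> \<open>k / a \<le> 1\<close>
    by (intro prob_power_event_count_ge_bound mult_left_mono_neg) auto
  finally show ?thesis .
qed

lemma prob_event_count_ge_le_sum:
  assumes "finite I" "\<And>i. i \<in> I \<Longrightarrow> A i \<in> events" "0 < k"
  shows "prob {\<omega> \<in> space M. k \<le> event_count A I \<omega>} \<le> (\<Sum>i\<in>I. prob (A i))"
proof -
  have "{\<omega> \<in> space M. k \<le> event_count A I \<omega>} \<subseteq> (\<Union>i\<in>I. A i)"
  proof
    fix \<omega> assume "\<omega> \<in> {\<omega> \<in> space M. k \<le> event_count A I \<omega>}"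
    then have "card {i \<in> I. \<omega> \<in> A i} > 0" using \<open>0 < k\<close> by (simp add: event_count_def)
    then show "\<omega> \<in> (\<Union>i\<in>I. A i)" by (auto simp: card_gt_0_iff)
  qed
  then have "prob {\<omega> \<in> space M. k \<le> event_count A I \<omega>} \<le> prob (\<Union>i\<in>I. A i)"
    using assms by (intro finite_measure_mono) auto
  also have "\<dots> \<le> (\<Sum>i\<in>I. prob (A i))"
    using assms by (intro finite_measure_subadditive_finite) auto
  finally show ?thesis .
qed

lemma prob_event_count_ge_bound:
  fixes a :: real
  assumes "finite I" "indep_events A I" "0 < k" "a \<le> k" "(\<Sum>i\<in>I. prob (A i)) \<le> a"
  shows "prob {\<omega> \<in> space M. k \<le> event_count A I \<omega>} \<le> chernoff_bound k a"
proof (cases "a > 0")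
  case True
  then have "1 \<le> k / a" using assms(3,4) by simp
  then have "prob {\<omega> \<in> space M. k \<le> event_count A I \<omega>}
      \<le> prob {\<omega> \<in> space M. (k / a) ^ k \<le> (k / a) ^ event_count A I \<omega>}"
    using integrable_power_event_count[OF assms(1,2), THEN borel_measurable_integrable]
    by (intro finite_measure_mono) (auto intro!: power_increasing)
  also have "\<dots> \<le> chernoff_bound k a"
    using assms True \<open>1 \<le> k / a\<close> by (intro prob_power_event_count_ge_bound mult_left_mono) auto
  finally show ?thesis .
next
  case False
  txt \<open>The optimal \<open>t = k / a\<close> would be infinite, but every event is null.\<close>
  have "0 \<le> (\<Sum>i\<in>I. prob (A i))" by (simp add: sum_nonneg)
  then have "a = 0" using False assms(5) by simp
  moreover have "prob {\<omega> \<in> space M. k \<le> event_count A I \<omega>} \<le> (\<Sum>i\<in>I. prob (A i))"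
    using assms(1-3) by (intro prob_event_count_ge_le_sum) (auto simp: indep_events_def)
  ultimately show ?thesis using assms(5) \<open>0 < k\<close> by (simp add: chernoff_bound_def power_0_left)
qed

lemma prob_knn_dist_gt_bound:
  fixes X :: "nat \<Rightarrow> 'a \<Rightarrow> 'b::metric_space" and x :: 'b and r a :: real
  defines "A \<equiv> \<lambda>i. {\<omega> \<in> space M. X i \<omega> \<in> cball x r}"
  assumes "indep_events A {1..n}" "1 \<le> k" "k \<le> n" "k \<le> a" "a \<le> (\<Sum>i=1..n. prob (A i))"
  shows "prob {\<omega> \<in> space M. knn_dist k n (\<lambda>i. X i \<omega>) x > r} \<le> chernoff_bound k a"
proof -
  have "prob {\<omega> \<in> space M. knn_dist k n (\<lambda>i. X i \<omega>) x > r}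
      \<le> prob {\<omega> \<in> space M. event_count A {1..n} \<omega> \<le> k}"
  proof (rule finite_measure_mono)
    show "{\<omega> \<in> space M. knn_dist k n (\<lambda>i. X i \<omega>) x > r}
        \<subseteq> {\<omega> \<in> space M. event_count A {1..n} \<omega> \<le> k}"
      using assms(3,4) by (auto simp: knn_dist_le_iff event_count_def A_def not_le[symmetric])
    show "{\<omega> \<in> space M. event_count A {1..n} \<omega> \<le> k} \<in> events"
      using measurable_event_count[of "{1..n}" A] assms(2)
      by (auto simp: indep_events_def)
  qed
  also have "\<dots> \<le> chernoff_bound k a"
    using assms by (intro prob_event_count_le_bound) auto
  finally show ?thesis .
qed

lemma prob_knn_dist_le_bound:
  fixes X :: "nat \<Rightarrow> 'a \<Rightarrow> 'b::metric_space" and x :: 'b and r a :: real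
  defines "A \<equiv> \<lambda>i. {\<omega> \<in> space M. X i \<omega> \<in> cball x r}"
  assumes "indep_events A {1..n}" "1 \<le> k" "k \<le> n" "a \<le> k" "(\<Sum>i=1..n. prob (A i)) \<le> a"
  shows "prob {\<omega> \<in> space M. knn_dist k n (\<lambda>i. X i \<omega>) x \<le> r} \<le> chernoff_bound k a"
proof -
  have "{\<omega> \<in> space M. knn_dist k n (\<lambda>i. X i \<omega>) x \<le> r}
      = {\<omega> \<in> space M. k \<le> event_count A {1..n} \<omega>}"
    using assms(3,4) by (auto simp: knn_dist_le_iff event_count_def A_def)
  then show ?thesis
    using prob_event_count_ge_bound[of "{1..n}" A k a] assms(2-6) by simp
qed

lemma indep_events_in_sets:
  assumes "indep_vars N X I" "\<And>i. i \<in> I \<Longrightarrow> A i \<in> sets (N i)"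
  shows "indep_events (\<lambda>i. {\<omega> \<in> space M. X i \<omega> \<in> A i}) I"
proof (rule indep_eventsI_indep_vars[OF assms(1)])
  fix i assume "i \<in> I"
  then have "{y \<in> space (N i). y \<in> A i} = A i"
    using assms(2) sets.sets_into_space by blast
  then show "{y \<in> space (N i). y \<in> A i} \<in> sets (N i)"
    using assms(2)[OF \<open>i \<in> I\<close>] by simp
qed

lemma
  fixes X :: "nat \<Rightarrow> 'a \<Rightarrow> 'b::metric_space"
  assumes indep: "indep_vars (\<lambda>_. N) X {1..n}"
    and distr: "\<And>i. i \<in> {1..n} \<Longrightarrow> distr M N (X i) = N"
    and cball: "cball x r \<in> sets N" and k: "1 \<le> k" "k \<le> n"
  shows prob_iid_knn_dist_gt_bound:
      "\<lbrakk>k \<le> q * n; q \<le> measure N (cball x r)\<rbrakk>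
        \<Longrightarrow> prob {\<omega> \<in> space M. knn_dist k n (\<lambda>i. X i \<omega>) x > r}
          \<le> chernoff_bound k (q * n)"
    and prob_iid_knn_dist_le_bound:
      "\<lbrakk>q * n \<le> k; measure N (cball x r) \<le> q\<rbrakk>
        \<Longrightarrow> prob {\<omega> \<in> space M. knn_dist k n (\<lambda>i. X i \<omega>) x \<le> r}
          \<le> chernoff_bound k (q * n)"
proof -
  have events: "indep_events (\<lambda>i. {\<omega> \<in> space M. X i \<omega> \<in> cball x r}) {1..n}"
    using indep cball by (rule indep_events_in_sets)
  have "prob {\<omega> \<in> space M. X i \<omega> \<in> cball x r} = measure N (cball x r)" if "i \<in> {1..n}" for i
  proof -
    have "random_variable N (X i)" using indep that by (simp add: indep_vars_def)
    from measure_distr[OF this cball] show ?thesis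
      by (simp add: distr[OF that] vimage_def Int_def conj_commute)
  qed
  then have mean: "(\<Sum>i=1..n. prob {\<omega> \<in> space M. X i \<omega> \<in> cball x r}) = measure N (cball x r) * n"
    by simp
  show "prob {\<omega> \<in> space M. knn_dist k n (\<lambda>i. X i \<omega>) x > r} \<le> chernoff_bound k (q * n)"
    if "k \<le> q * n" "q \<le> measure N (cball x r)"
    using that by (intro prob_knn_dist_gt_bound[OF events k])
      (simp_all only: mean mult_right_mono of_nat_0_le_iff)
  show "prob {\<omega> \<in> space M. knn_dist k n (\<lambda>i. X i \<omega>) x \<le> r} \<le> chernoff_bound k (q * n)"
    if "q * n \<le> k" "measure N (cball x r) \<le> q"
    using that by (intro prob_knn_dist_le_bound[OF events k])
      (simp_all only: mean mult_right_mono of_nat_0_le_iff)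
qed

end

lemma measure_cball_le_tendsto_at_right:
  fixes M :: "'a::metric_space measure"
  assumes "finite_measure M" and borel: "sets borel \<subseteq> sets M"
    and ball_le: "\<forall>\<^sub>F s in at_right r. measure M (ball x s) \<le> f s"
    and tendsto: "(f \<longlongrightarrow> l) (at_right r)"
  shows "measure M (cball x r) \<le> l"
proof (rule tendsto_lowerbound[OF tendsto])
  show "\<forall>\<^sub>F s in at_right r. measure M (cball x r) \<le> f s"
    using ball_le eventually_at_right_less
  proof eventually_elim
    case (elim s)
    have "measure M (cball x r) \<le> measure M (ball x s)"
      using assms(1) borel \<open>r < s\<close> by (intro finite_measure.finite_measure_mono) auto
    then show ?case using elim by linarith
  qed
qed simp

lemma full_dimension_ineqs_imp_le:
  assumes "full_dimension_ineqs P D \<rho> \<gamma>\<^sub>l \<gamma>\<^sub>u x" "0 < \<rho>"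
  shows "\<gamma>\<^sub>l x \<le> \<gamma>\<^sub>u x"
proof -
  have "\<gamma>\<^sub>l x * \<rho> powr D \<le> measure P (ball x \<rho>)" "measure P (ball x \<rho>) \<le> \<gamma>\<^sub>u x * \<rho> powr D"
    using assms by (simp_all add: full_dimension_ineqs_def)
  then have "\<gamma>\<^sub>l x * \<rho> powr D \<le> \<gamma>\<^sub>u x * \<rho> powr D" by (rule order_trans)
  then show ?thesis using \<open>0 < \<rho>\<close> by simp
qed

lemma full_dimension_ineqs_measure_cball_ge:
  fixes M :: "'a::metric_space measure"
  assumes "finite_measure M" "sets borel \<subseteq> sets M"
    and "full_dimension_ineqs M D \<rho> \<gamma>\<^sub>l \<gamma>\<^sub>u x" "0 \<le> r" "r \<le> \<rho>"
  shows "\<gamma>\<^sub>l x * r powr D \<le> measure M (cball x r)"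
proof -
  have "\<gamma>\<^sub>l x * r powr D \<le> measure M (ball x r)"
    using assms by (simp add: full_dimension_ineqs_def)
  also have "\<dots> \<le> measure M (cball x r)"
    using assms(1,2) by (intro finite_measure.finite_measure_mono) auto
  finally show ?thesis .
qed

lemma full_dimension_ineqs_measure_cball_le:
  fixes M :: "'a::metric_space measure"
  assumes "finite_measure M" and borel: "sets borel \<subseteq> sets M"
    and ineqs: "full_dimension_ineqs M D \<rho> \<gamma>\<^sub>l \<gamma>\<^sub>u x"
    and "0 < D" "0 \<le> r" "r \<le> \<rho>" and sphere: "r = \<rho> \<Longrightarrow> measure M (sphere x r) = 0"
  shows "measure M (cball x r) \<le> \<gamma>\<^sub>u x * r powr D"
proof (cases "r = \<rho>")
  case True
  have "measure M (cball x r) = measure M (ball x r \<union> sphere x r)"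
    by (rule arg_cong[where f = "measure M"]) auto
  also have "\<dots> \<le> measure M (ball x r) + measure M (sphere x r)"
    using borel by (intro measure_Un_le) (auto simp flip: cball_diff_eq_sphere)
  also have "\<dots> \<le> \<gamma>\<^sub>u x * r powr D"
    using ineqs sphere True \<open>0 \<le> r\<close> by (simp add: full_dimension_ineqs_def)
  finally show ?thesis .
next
  case False
  show ?thesis
  proof (rule measure_cball_le_tendsto_at_right[OF assms(1) borel])
    have "\<forall>\<^sub>F s in at_right r. s \<in> {r<..<\<rho>}"
      using False \<open>r \<le> \<rho>\<close> by (intro eventually_at_right_real) auto
    then show "\<forall>\<^sub>F s in at_right r. measure M (ball x s) \<le> \<gamma>\<^sub>u x * s powr D"
      by eventually_elim (use ineqs \<open>0 \<le> r\<close> in \<open>auto simp: full_dimension_ineqs_def\<close>)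
    show "((\<lambda>s. \<gamma>\<^sub>u x * s powr D) \<longlongrightarrow> \<gamma>\<^sub>u x * r powr D) (at_right r)"
      using \<open>0 < D\<close> \<open>0 \<le> r\<close> by (intro tendsto_intros) (auto simp: eventually_at_filter)
  qed
qed

lemma (in prob_space)
  fixes X :: "nat \<Rightarrow> 'a \<Rightarrow> 'b::metric_space" and P :: "'b measure"
  assumes iid: "indep_vars (\<lambda>_. P) X {1..n}" "\<And>i. i \<in> {1..n} \<Longrightarrow> distr M P (X i) = P"
    and P: "finite_measure P" "sets borel \<subseteq> sets P" "full_dimension_ineqs P D \<rho> \<gamma>\<^sub>l \<gamma>\<^sub>u x"
    and "0 < D" and k: "1 \<le> k" "k \<le> n" and "r \<le> \<rho>"
  shows prob_knn_dist_gt_full_dimension_bound: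
      "\<lbrakk>0 < \<gamma>\<^sub>l x; (k / (\<gamma>\<^sub>l x * n)) powr (1 / D) \<le> r\<rbrakk>
        \<Longrightarrow> prob {\<omega> \<in> space M. knn_dist k n (\<lambda>i. X i \<omega>) x > r}
          \<le> chernoff_bound k (\<gamma>\<^sub>l x * r powr D * n)"
    and prob_knn_dist_le_full_dimension_bound:
      "\<lbrakk>0 < \<gamma>\<^sub>u x; 0 \<le> r; r \<le> (k / (\<gamma>\<^sub>u x * n)) powr (1 / D);
          r = \<rho> \<Longrightarrow> measure P (sphere x r) = 0\<rbrakk>
        \<Longrightarrow> prob {\<omega> \<in> space M. knn_dist k n (\<lambda>i. X i \<omega>) x \<le> r}
          \<le> chernoff_bound k (\<gamma>\<^sub>u x * r powr D * n)"
proof -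
  have cball: "cball x r \<in> sets P" using P(2) by auto
  show "prob {\<omega> \<in> space M. knn_dist k n (\<lambda>i. X i \<omega>) x > r} \<le> chernoff_bound k (\<gamma>\<^sub>l x * r powr D * n)"
    if "0 < \<gamma>\<^sub>l x" and r: "(k / (\<gamma>\<^sub>l x * n)) powr (1 / D) \<le> r"
  proof (rule prob_iid_knn_dist_gt_bound[OF iid cball k])
    have "0 \<le> r" using r order_trans[OF powr_ge_zero] by auto
    then have "k / (\<gamma>\<^sub>l x * n) \<le> r powr D"
      using that \<open>0 < D\<close> powr_le_iff_le_powr_inverse[of "k / (\<gamma>\<^sub>l x * n)" r "1 / D"] by simp
    then show "k \<le> \<gamma>\<^sub>l x * r powr D * n"
      using that(1) k by (simp add: field_simps)
    show "\<gamma>\<^sub>l x * r powr D \<le> measure P (cball x r)"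
      using P \<open>0 \<le> r\<close> \<open>r \<le> \<rho>\<close> by (rule full_dimension_ineqs_measure_cball_ge)
  qed
  show "prob {\<omega> \<in> space M. knn_dist k n (\<lambda>i. X i \<omega>) x \<le> r} \<le> chernoff_bound k (\<gamma>\<^sub>u x * r powr D * n)"
    if "0 < \<gamma>\<^sub>u x" "0 \<le> r" "r \<le> (k / (\<gamma>\<^sub>u x * n)) powr (1 / D)"
      and sphere: "r = \<rho> \<Longrightarrow> measure P (sphere x r) = 0"
  proof (rule prob_iid_knn_dist_le_bound[OF iid cball k])
    have "r powr D \<le> k / (\<gamma>\<^sub>u x * n)"
      using that(1-3) \<open>0 < D\<close> by (simp add: powr_le_iff_le_powr_inverse)
    then show "\<gamma>\<^sub>u x * r powr D * n \<le> k"
      using that(1) k by (simp add: field_simps)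
    show "measure P (cball x r) \<le> \<gamma>\<^sub>u x * r powr D"
      using P \<open>0 < D\<close> \<open>0 \<le> r\<close> \<open>r \<le> \<rho>\<close> sphere by (rule full_dimension_ineqs_measure_cball_le)
  qed
qed

theorem lemma6:
  fixes \<mu> P :: "'a::metric_space measure"
    and D c\<^sub>D \<rho> :: real
    and S :: "'a set"
    and \<gamma>\<^sub>l \<gamma>\<^sub>u p :: "'a \<Rightarrow> real"
    and k n :: nat
    and \<Omega> :: "'w measure"
    and X :: "nat \<Rightarrow> 'w \<Rightarrow> 'a"
    and x :: 'a
  assumes "metric_measure_space \<mu>"
    and "D > 0" and "has_dimension \<mu> D c\<^sub>D \<rho>"
    and "prob_space P" and "sets P = sets \<mu>" and "absolutely_continuous \<mu> P"
    and "full_dimension_on \<mu> P D \<rho> S \<gamma>\<^sub>l \<gamma>\<^sub>u"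
    and "has_density_on \<mu> P S p"
    and "1 \<le> k" and "k \<le> n"
    and "prob_space \<Omega>"
    and "prob_space.indep_vars \<Omega> (\<lambda>_. P) X {1..n}"
    and "\<And>i. i \<in> {1..n} \<Longrightarrow> distr \<Omega> P (X i) = P"
    and "x \<in> S" and "full_dimension_ineqs P D \<rho> \<gamma>\<^sub>l \<gamma>\<^sub>u x"
  shows "(\<forall>r \<in> {(real k / (\<gamma>\<^sub>l x * real n)) powr (1 / D) .. \<rho>}.
            measure \<Omega> {\<omega> \<in> space \<Omega>. knn_dist k n (\<lambda>i. X i \<omega>) x > r}
              \<le> exp (- (\<gamma>\<^sub>l x * r powr D * real n))
                 * (exp 1 * (\<gamma>\<^sub>l x * r powr D * real n / real k)) ^ k)
       \<and> (\<forall>r \<in> {0 .. min ((real k / (\<gamma>\<^sub>u x * real n)) powr (1 / D)) \<rho>}.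
            (r = \<rho> \<longrightarrow> measure P (sphere x r) = 0) \<longrightarrow>
            measure \<Omega> {\<omega> \<in> space \<Omega>. knn_dist k n (\<lambda>i. X i \<omega>) x \<le> r}
              \<le> (exp 1 * \<gamma>\<^sub>u x * r powr D * real n / real k) powr (real k * \<gamma>\<^sub>l x / \<gamma>\<^sub>u x))"
proof -
  interpret \<Omega>: prob_space \<Omega> by fact
  interpret P: prob_space P by fact
  have P: "finite_measure P" "sets borel \<subseteq> sets P" "full_dimension_ineqs P D \<rho> \<gamma>\<^sub>l \<gamma>\<^sub>u x"
    using assms(1,5,15) P.finite_measure_axioms by (auto dest: metric_measure_space.borel_subset_sets)
  have \<gamma>: "0 < \<gamma>\<^sub>l x" "0 < \<gamma>\<^sub>u x" "\<gamma>\<^sub>l x \<le> \<gamma>\<^sub>u x"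
    using assms(3,7,14) full_dimension_ineqs_imp_le[OF assms(15)]
    by (auto simp: full_dimension_on_def has_dimension_def)
  note tails = assms(12,13) P assms(2,9,10)
  show ?thesis
  proof (intro conjI ballI impI)
    fix r assume "r \<in> {(k / (\<gamma>\<^sub>l x * n)) powr (1 / D) .. \<rho>}"
    then show "\<Omega>.prob {\<omega> \<in> space \<Omega>. knn_dist k n (\<lambda>i. X i \<omega>) x > r}
        \<le> exp (- (\<gamma>\<^sub>l x * r powr D * n)) * (exp 1 * (\<gamma>\<^sub>l x * r powr D * n / k)) ^ k"
      using \<Omega>.prob_knn_dist_gt_full_dimension_bound[OF tails, of r] \<gamma>
      by (simp add: chernoff_bound_def)
  next
    fix r assume r: "r \<in> {0 .. min ((k / (\<gamma>\<^sub>u x * n)) powr (1 / D)) \<rho>}"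
      and sphere: "r = \<rho> \<longrightarrow> P.prob (sphere x r) = 0"
    let ?p = "\<Omega>.prob {\<omega> \<in> space \<Omega>. knn_dist k n (\<lambda>i. X i \<omega>) x \<le> r}"
    let ?a = "\<gamma>\<^sub>u x * r powr D * n"
    have "?p \<le> chernoff_bound k ?a"
      using r sphere \<gamma> by (intro \<Omega>.prob_knn_dist_le_full_dimension_bound[OF tails]) auto
    then have "?p \<le> min 1 (chernoff_bound k ?a)" by simp
    also have "\<dots> \<le> (exp 1 * ?a / k) powr (k * \<gamma>\<^sub>l x / \<gamma>\<^sub>u x)"
      using \<gamma> assms(9)
      by (intro min_one_chernoff_bound_le_powr) (auto simp: field_simps mult_left_mono)
    finally show "?p \<le> (exp 1 * \<gamma>\<^sub>u x * r powr D * n / k) powr (k * \<gamma>\<^sub>l x / \<gamma>\<^sub>u x)"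
      by (simp add: mult.assoc)
  qed
qed

end
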